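(* Let $f\in\mathcal{C}_{q}$ with $f(z)=z+\sum_{n=2}^{\infty}a_nz^n$. Then \begin{enumerate} \item[(i)] $|\sigma_3(f)(0)|\le 1$; \item[(ii)] $|\sigma_4(f)(0)|\le 2$. \end{enumerate} Both estimates are sharp. Equality in (i) is attained by the function $f_3\in\mathcal{C}_{q}$ (normalized by $f_3(0)=0$, $f_3'(0)=1$) corresponding to the Schwarz function $\omega(z)=z^2$, that is, $1+\dfrac{zf_3''(z)}{f_3'(z)}=q(z^2)$. Equality in (ii) is attained by the function $f_4\in\mathcal{C}_{q}$ (normalized by $f_4(0)=0$, $f_4'(0)=1$) corresponding to the Schwarz function $\omega(z)=z^3$, that is, $1+\dfrac{zf_4''(z)}{f_4'(z)}=q(z^3)$.
   Context: Let $\mathbb{D}=\{z\in\mathbb{C}:|z|<1\}$. Let $\mathcal{A}$ be the class of analytic functions $f$ on $\mathbb{D}$ with $f(0)=0$, $f'(0)=1$, and let $\mathcal{S}\subset\mathcal{A}$ be the subclass of univalent (injective) functions. A Schwarz function is an analytic function $\omega$ on $\mathbb{D}$ with $\omega(0)=0$ and $|\omega(z)|<1$ for all $z\in\mathbb{D}$. For analytic functions $g,h$ on $\mathbb{D}$, $g\prec h$ ($g$ is subordinate to $h$) means $g(z)=h(\omega(z))$ on $\mathbb{D}$ for some Schwarz function $\omega$. Let $q(z)=z+\sqrt{1+z^2}$ for $z\in\mathbb{D}$ (principal branch of the square root, so $q(0)=1$). The lune-convex class is $$\mathcal{C}_{q}=\left\{f\in\mathcal{S}:1+\frac{zf''(z)}{f'(z)}\prec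 q(z)\right\}.$$ For locally univalent $f$, the higher-order Schwarzian derivatives (Schippers functionals) are defined by $$\sigma_3(f)=\left(\frac{f''}{f'}\right)'-\frac12\left(\frac{f''}{f'}\right)^2,\qquad \sigma_{n+1}(f)=\sigma_n'(f)-(n-1)\,\sigma_n(f)\,\frac{f''}{f'}\quad(n\ge 3),$$ where $\sigma_n'(f)$ is the derivative in $z$ of $\sigma_n(f)$. For $f(z)=z+\sum_{n\ge2}a_nz^n$ one has $\sigma_3(f)(0)=6(a_3-a_2^2)$ and $\sigma_4(f)(0)=24(a_4-3a_2a_3+2a_2^3)$. *)

theory Defs
  imports "HOL-Complex_Analysis.Complex_Analysis"
begin

text \<open>
  Functions on the unit disc are total functions on \<open>complex\<close>; only their values on \<open>ball 0 1\<close>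
  matter. Since the disc is open, \<open>deriv\<close> at its points depends on those values only.
\<close>

definition class_A :: "(complex \<Rightarrow> complex) set" where
  "class_A = {f. f holomorphic_on ball 0 1 \<and> f 0 = 0 \<and> deriv f 0 = 1}"

definition class_S :: "(complex \<Rightarrow> complex) set" where
  "class_S = {f \<in> class_A. inj_on f (ball 0 1)}"

definition schwarz_function :: "(complex \<Rightarrow> complex) \<Rightarrow> bool" where
  "schwarz_function \<omega> \<longleftrightarrow>
     \<omega> holomorphic_on ball 0 1 \<and> \<omega> 0 = 0 \<and> (\<forall>z\<in>ball 0 1. norm (\<omega> z) < 1)"

definition subordinate :: "(complex \<Rightarrow> complex) \<Rightarrow> (complex \<Rightarrow> complex) \<Rightarrow> bool" where
  "subordinate g h \<longleftrightarrow>
     g holomorphic_on ball 0 1 \<and> h holomorphic_on ball 0 1 \<and>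
     (\<exists>\<omega>. schwarz_function \<omega> \<and> (\<forall>z\<in>ball 0 1. g z = h (\<omega> z)))"

definition q_lune :: "complex \<Rightarrow> complex" where
  "q_lune z = z + csqrt (1 + z\<^sup>2)"

definition pre_schwarzian :: "(complex \<Rightarrow> complex) \<Rightarrow> complex \<Rightarrow> complex" where
  "pre_schwarzian f z = deriv (deriv f) z / deriv f z"

definition lune_convex :: "(complex \<Rightarrow> complex) set" where
  "lune_convex =
     {f \<in> class_S. subordinate (\<lambda>z. 1 + z * deriv (deriv f) z / deriv f z) q_lune}"

text \<open>
  The Schippers functionals \<open>\<sigma>\<^sub>n(f)\<close>, indexed as in the literature, so that \<open>n = 3\<close> is the
  Schwarzian derivative. They are only defined for \<open>n \<ge> 3\<close>; smaller indices get the dummy value 0.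
\<close>

primrec schippers :: "nat \<Rightarrow> (complex \<Rightarrow> complex) \<Rightarrow> complex \<Rightarrow> complex" where
  "schippers 0 f = (\<lambda>z. 0)"
| "schippers (Suc n) f =
     (if n < 2 then (\<lambda>z. 0)
      else if n = 2 then (\<lambda>z. deriv (pre_schwarzian f) z - 1 / 2 * (pre_schwarzian f z)\<^sup>2)
      else (\<lambda>z. deriv (schippers n f) z - (of_nat n - 1) * schippers n f z * pre_schwarzian f z))"

end

theory Submission
  imports Defs
begin

text \<open>
  Let \<open>f\<close> be lune-convex with Schwarz function \<open>\<omega>(z) = c\<^sub>1 z + c\<^sub>2 z\<^sup>2 + c\<^sub>3 z\<^sup>3 + \<dots>\<close>, and let
  \<open>P = f''/f'\<close>. The function \<open>q\<close> is a root of \<open>q\<^sup>2 - 2 w q = 1\<close>, so \<open>1 + z P(z)\<close> satisfies this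
  equation with \<open>w = \<omega>(z)\<close>. Comparing coefficients there gives the first three coefficients of
  \<open>P\<close>, and hence \<open>\<sigma>\<^sub>3(f)(0) = c\<^sub>2\<close> and \<open>\<sigma>\<^sub>4(f)(0) = 2 c\<^sub>3 - c\<^sub>1 c\<^sub>2 - c\<^sub>1\<^sup>3/2\<close>
  (\<open>schippers_at_0_schwarz\<close>).

  Both bounds come from a single principle: multiplication by a function bounded by 1 does not
  increase the \<open>\<ell>\<^sup>2\<close> norm of the coefficients (\<open>bounded_multiplier_contraction\<close>). Applied to
  \<open>\<omega> \<cdot> 1\<close> it gives \<open>\<bar>c\<^sub>2\<bar> \<le> 1\<close>. For \<open>\<sigma>\<^sub>4\<close> it is applied to \<open>\<omega> \<cdot> p\<close> with
  \<open>p = 1 - c\<^sub>1 z/2 - c\<^sub>1\<^sup>2 z\<^sup>2/4\<close>: this polynomial, which depends on \<open>\<omega>\<close>, makes the coefficient of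
  \<open>z\<^sup>3\<close> equal to \<open>F = c\<^sub>3 - c\<^sub>1 c\<^sub>2/2 - c\<^sub>1\<^sup>3/4\<close>, which is half of \<open>\<sigma>\<^sub>4(f)(0)\<close>. Keeping also the
  coefficient \<open>c\<^sub>1\<close> of \<open>z\<close>, one obtains
  \<open>\<bar>c\<^sub>1\<bar>\<^sup>2 + \<bar>F\<bar>\<^sup>2 \<le> 1 + \<bar>c\<^sub>1\<bar>\<^sup>2/4 + \<bar>c\<^sub>1\<bar>\<^sup>4/16\<close>, and \<open>\<bar>c\<^sub>1\<bar> \<le> 1\<close> then forces \<open>\<bar>F\<bar> \<le> 1\<close>.

  For the sharpness, the equation with \<open>\<omega>(z) = z\<^sup>k\<close> is solved by two integrations, first for
  \<open>log f'\<close> and then for \<open>f\<close>. Univalence is the delicate point. Since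
  \<open>\<bar>q(w) - 1\<bar> \<le> 2 \<bar>w\<bar>\<close>, one finds \<open>\<bar>log f'\<bar> \<le> 2/k \<le> 1 < \<pi>/2\<close> for \<open>k \<ge> 2\<close>, so \<open>f'\<close> has
  positive real part and the Noshiro-Warschawski criterion (\<open>inj_on_if_Re_deriv_pos\<close>) applies
  (\<open>lune_convex_power_exists\<close>). The solution is unique because the equation determines \<open>f''/f'\<close>.
\<close>

section \<open>Coefficients of bounded holomorphic functions\<close>

text \<open>
  On the circle of radius \<open>r\<close> one has \<open>cnj z = r\<^sup>2/z\<close>, so this is the Cauchy formula for the
  \<open>k\<close>-th derivative at 0, written as an integral over the angle. In this form the coefficients
  appear as inner products with the powers of \<open>z\<close>.
\<close>

lemma has_integral_circle_coefficient:
  fixes f :: "complex \<Rightarrow> complex" and r R :: real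
  assumes "f holomorphic_on ball 0 R" "f has_fps_expansion F" "0 < r" "r < R"
  shows "((\<lambda>t. f (r * cis t) * cnj (r * cis t) ^ k) has_integral 2 * pi * r ^ (2 * k) * fps_nth F k)
           {0..2 * pi}"
proof -
  have "cball 0 r \<subseteq> ball (0 :: complex) R"
    using assms by auto
  hence "continuous_on (cball 0 r) f" "f holomorphic_on ball 0 r"
    using assms(1) ball_subset_cball[of 0 r]
    by (meson holomorphic_on_imp_continuous_on holomorphic_on_subset order_trans)+
  hence "((\<lambda>u. f u / (u - 0) ^ Suc k) has_contour_integral
           (2 * pi * \<i>) / fact k * (deriv ^^ k) f 0) (circlepath 0 r)"
    using assms by (intro Cauchy_has_contour_integral_higher_derivative_circlepath) auto
  hence "((\<lambda>t. f (r * cis t) / (r * cis t) ^ Suc k * r * \<i> * cis t) has_integral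
           (2 * pi * \<i>) * fps_nth F k) {0..2 * pi}"
    unfolding circlepath_def
    by (subst (asm) has_contour_integral_part_circlepath_iff)
       (auto simp: fps_nth_fps_expansion[OF assms(2)])
  from has_integral_mult_right[OF this, of "of_real (r ^ (2 * k)) / \<i>"]
  have "((\<lambda>t. of_real (r ^ (2 * k)) / \<i> * (f (r * cis t) / (r * cis t) ^ Suc k * r * \<i> * cis t))
          has_integral 2 * pi * r ^ (2 * k) * fps_nth F k) {0..2 * pi}"
    by (simp add: mult_ac)
  moreover have "of_real (r ^ (2 * k)) / \<i> * (f (r * cis t) / (r * cis t) ^ Suc k * r * \<i> * cis t)
      = f (r * cis t) * cnj (r * cis t) ^ k" for t
  proof -
    have "cnj (r * cis t) = of_real (r\<^sup>2) / (r * cis t)"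
      using assms(3) by (simp add: field_simps power2_eq_square cis_cnj cis_mult)
    hence "cnj (r * cis t) ^ k = of_real (r ^ (2 * k)) / (r * cis t) ^ k"
      by (simp only: power_divide power_mult of_real_power)
    thus ?thesis
      using assms(3) by (simp only: power_Suc) (simp add: field_simps)
  qed
  ultimately show ?thesis
    by simp
qed

lemma has_fps_expansion_poly: "poly (p :: complex poly) has_fps_expansion fps_of_poly p"
proof (induction p)
  case (pCons a p)
  have "(\<lambda>x. a + x * poly p x) has_fps_expansion fps_const a + fps_X * fps_of_poly p"
    by (intro fps_expansion_intros pCons.IH)
  thus ?case
    by (simp add: fps_of_poly_pCons poly_pCons[abs_def] add.commute mult.commute)
qed auto

lemma has_integral_circle_cnj_poly:
  fixes f :: "complex \<Rightarrow> complex" and r R :: real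
  assumes "f holomorphic_on ball 0 R" "f has_fps_expansion F" "0 < r" "r < R"
  shows "((\<lambda>t. f (r * cis t) * cnj (poly p (r * cis t))) has_integral
           2 * pi * (\<Sum>k\<le>degree p. r ^ (2 * k) * (fps_nth F k * cnj (coeff p k)))) {0..2 * pi}"
proof -
  have "((\<lambda>t. \<Sum>k\<le>degree p. f (r * cis t) * cnj (r * cis t) ^ k * cnj (coeff p k)) has_integral
          (\<Sum>k\<le>degree p. 2 * pi * r ^ (2 * k) * fps_nth F k * cnj (coeff p k))) {0..2 * pi}"
    by (intro has_integral_sum has_integral_mult_left has_integral_circle_coefficient[OF assms]) auto
  thus ?thesis
    by (simp add: poly_altdef sum_distrib_left mult_ac)
qed

lemma has_integral_circle_norm_poly:
  fixes p :: "complex poly" and r :: real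
  assumes "0 < r"
  shows "((\<lambda>t. (norm (poly p (r * cis t)))\<^sup>2) has_integral
           2 * pi * (\<Sum>k\<le>degree p. r ^ (2 * k) * (norm (coeff p k))\<^sup>2)) {0..2 * pi}"
proof -
  have "((\<lambda>t. poly p (r * cis t) * cnj (poly p (r * cis t))) has_integral
      2 * pi * (\<Sum>k\<le>degree p. r ^ (2 * k) * (fps_nth (fps_of_poly p) k * cnj (coeff p k)))) {0..2 * pi}"
    by (intro has_integral_circle_cnj_poly[where R = "r + 1"] has_fps_expansion_poly
          holomorphic_intros) (use assms in auto)
  also have "(\<lambda>t. poly p (r * cis t) * cnj (poly p (r * cis t))) =
      (\<lambda>t. complex_of_real ((norm (poly p (r * cis t)))\<^sup>2))"
    by (simp only: complex_norm_square)
  also have "2 * pi * (\<Sum>k\<le>degree p. r ^ (2 * k) * (fps_nth (fps_of_poly p) k * cnj (coeff p k))) =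
      complex_of_real (2 * pi * (\<Sum>k\<le>degree p. r ^ (2 * k) * (norm (coeff p k))\<^sup>2))"
    by (simp flip: complex_norm_square)
  finally show ?thesis
    by (auto dest: has_integral_Re)
qed

text \<open>
  Bessel's inequality: the error \<open>f - p\<close> of the \<open>n\<close>-th Taylor polynomial \<open>p\<close> has no coefficients up
  to \<open>n\<close> and is therefore orthogonal to \<open>p\<close> on the circle, so the mean square of \<open>f\<close> is at least
  that of \<open>p\<close>.
\<close>

lemma bessel_circle:
  fixes f :: "complex \<Rightarrow> complex" and r R :: real
  assumes "f holomorphic_on ball 0 R" "f has_fps_expansion F" "0 < r" "r < R"
  shows "2 * pi * (\<Sum>k\<le>n. r ^ (2 * k) * (norm (fps_nth F k))\<^sup>2) \<le>
           integral {0..2 * pi} (\<lambda>t. (norm (f (r * cis t)))\<^sup>2)"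
proof -
  define p where "p = (\<Sum>k\<le>n. monom (fps_nth F k) k)"
  have coeff_p: "coeff p k = (if k \<le> n then fps_nth F k else 0)" for k
    by (auto simp: p_def coeff_sum)
  have deg_p: "degree p \<le> n"
    unfolding p_def by (intro degree_sum_le) (auto intro: order.trans[OF degree_monom_le])
  have parseval: "(\<Sum>k\<le>degree p. r ^ (2 * k) * (norm (coeff p k))\<^sup>2) =
      (\<Sum>k\<le>n. r ^ (2 * k) * (norm (fps_nth F k))\<^sup>2)"
    using deg_p by (intro sum.mono_neutral_cong_left) (auto simp: coeff_p coeff_eq_0 le_degree)
  have "((\<lambda>t. (f (r * cis t) - poly p (r * cis t)) * cnj (poly p (r * cis t))) has_integral
      2 * pi * (\<Sum>k\<le>degree p. r ^ (2 * k) * (fps_nth (F - fps_of_poly p) k * cnj (coeff p k))))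
      {0..2 * pi}"
    using assms by (intro has_integral_circle_cnj_poly[where R = R] has_fps_expansion_poly
          holomorphic_intros fps_expansion_intros) auto
  \<comment> \<open>Each summand vanishes: up to degree \<open>n\<close> the coefficients of \<open>f\<close> and \<open>p\<close> agree.\<close>
  also have "(\<Sum>k\<le>degree p. r ^ (2 * k) * (fps_nth (F - fps_of_poly p) k * cnj (coeff p k))) = 0"
    using deg_p by (intro sum.neutral) (auto simp: coeff_p)
  finally have "((\<lambda>t. (f (r * cis t) - poly p (r * cis t)) * cnj (poly p (r * cis t))) has_integral 0)
      {0..2 * pi}"
    by simp
  from has_integral_mult_right[OF has_integral_Re[OF this], of 2]
  have orth: "((\<lambda>t. 2 * Re ((f (r * cis t) - poly p (r * cis t)) * cnj (poly p (r * cis t))))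
      has_integral 0) {0..2 * pi}"
    by simp
  have cont: "continuous_on {0..2 * pi} (\<lambda>t. (norm (f (r * cis t)))\<^sup>2)"
    using assms
    by (intro continuous_intros continuous_on_compose2[OF holomorphic_on_imp_continuous_on[OF assms(1)]])
       (auto simp: norm_mult)
  have "2 * pi * (\<Sum>k\<le>n. r ^ (2 * k) * (norm (fps_nth F k))\<^sup>2) + 0 \<le>
      integral {0..2 * pi} (\<lambda>t. (norm (f (r * cis t)))\<^sup>2)"
  proof (rule has_integral_le)
    show "((\<lambda>t. (norm (poly p (r * cis t)))\<^sup>2 +
             2 * Re ((f (r * cis t) - poly p (r * cis t)) * cnj (poly p (r * cis t)))) has_integral
            2 * pi * (\<Sum>k\<le>n. r ^ (2 * k) * (norm (fps_nth F k))\<^sup>2) + 0) {0..2 * pi}"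
      using has_integral_add[OF has_integral_circle_norm_poly[OF assms(3), of p] orth]
      by (simp only: parseval)
    show "((\<lambda>t. (norm (f (r * cis t)))\<^sup>2) has_integral
            integral {0..2 * pi} (\<lambda>t. (norm (f (r * cis t)))\<^sup>2)) {0..2 * pi}"
      using cont by (intro integrable_integral integrable_continuous_real)
    fix t
    have "(norm (f (r * cis t)))\<^sup>2 - ((norm (poly p (r * cis t)))\<^sup>2 +
             2 * Re ((f (r * cis t) - poly p (r * cis t)) * cnj (poly p (r * cis t)))) =
          (norm (f (r * cis t) - poly p (r * cis t)))\<^sup>2"
      unfolding cmod_power2 by (simp add: power2_eq_square algebra_simps)
    thus "(norm (poly p (r * cis t)))\<^sup>2 +
             2 * Re ((f (r * cis t) - poly p (r * cis t)) * cnj (poly p (r * cis t))) \<le>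
          (norm (f (r * cis t)))\<^sup>2"
      by (metis diff_ge_0_iff_ge zero_le_power2)
  qed
  thus ?thesis
    by simp
qed

text \<open>
  On every circle \<open>\<bar>w p\<bar> \<le> \<bar>p\<bar>\<close>; comparing mean squares by Bessel's inequality on the left and
  Parseval's identity on the right, and letting the radius tend to 1, gives the claim. The freedom
  in choosing \<open>p\<close> is what makes this stronger than a bound on the single coefficients of \<open>w\<close>.
\<close>

lemma bounded_multiplier_contraction:
  fixes w :: "complex \<Rightarrow> complex"
  assumes "w holomorphic_on ball 0 1" "w has_fps_expansion W"
    and "\<And>z. z \<in> ball 0 1 \<Longrightarrow> norm (w z) \<le> 1"
  shows "(\<Sum>k\<le>n. (norm (fps_nth (W * fps_of_poly p) k))\<^sup>2) \<le> (\<Sum>k\<le>degree p. (norm (coeff p k))\<^sup>2)"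
proof -
  define A where "A = (\<lambda>r :: real. \<Sum>k\<le>n. r ^ (2 * k) * (norm (fps_nth (W * fps_of_poly p) k))\<^sup>2)"
  define B where "B = (\<lambda>r :: real. \<Sum>k\<le>degree p. r ^ (2 * k) * (norm (coeff p k))\<^sup>2)"
  have le: "A r \<le> B r" if "0 < r" "r < 1" for r
  proof -
    have hol: "(\<lambda>z. w z * poly p z) holomorphic_on ball 0 1"
      by (intro holomorphic_intros assms)
    have "2 * pi * A r \<le> integral {0..2 * pi} (\<lambda>t. (norm (w (r * cis t) * poly p (r * cis t)))\<^sup>2)"
      unfolding A_def using assms hol that
      by (intro bessel_circle[where R = 1] fps_expansion_intros has_fps_expansion_poly) auto
    also have "\<dots> \<le> 2 * pi * B r"
    proof (rule has_integral_le)
      have "continuous_on {0..2 * pi} (\<lambda>t. (norm (w (r * cis t) * poly p (r * cis t)))\<^sup>2)"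
        using that
        by (intro continuous_intros continuous_on_compose2[OF holomorphic_on_imp_continuous_on[OF assms(1)]])
           (auto simp: norm_mult)
      thus "((\<lambda>t. (norm (w (r * cis t) * poly p (r * cis t)))\<^sup>2) has_integral
              integral {0..2 * pi} (\<lambda>t. (norm (w (r * cis t) * poly p (r * cis t)))\<^sup>2)) {0..2 * pi}"
        by (intro integrable_integral integrable_continuous_real)
      show "((\<lambda>t. (norm (poly p (r * cis t)))\<^sup>2) has_integral 2 * pi * B r) {0..2 * pi}"
        unfolding B_def by (intro has_integral_circle_norm_poly that)
      fix t
      have "norm (w (r * cis t)) \<le> 1"
        using that by (intro assms) (auto simp: norm_mult)
      thus "(norm (w (r * cis t) * poly p (r * cis t)))\<^sup>2 \<le> (norm (poly p (r * cis t)))\<^sup>2"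
        by (auto intro!: power_mono mult_left_le_one_le simp: norm_mult)
    qed
    finally show ?thesis
      by simp
  qed
  have "A 1 \<le> B 1"
  proof (rule tendsto_le)
    show "(A \<longlongrightarrow> A 1) (at_left 1)" "(B \<longlongrightarrow> B 1) (at_left 1)"
      unfolding A_def B_def by (auto intro!: tendsto_eq_intros)
    show "eventually (\<lambda>r. A r \<le> B r) (at_left 1)"
      using eventually_at_left_real[of 0 "1 :: real"] by (auto elim!: eventually_mono intro: le)
  qed auto
  thus ?thesis
    by (simp add: A_def B_def)
qed

section \<open>Schippers functionals in terms of the Schwarz function\<close>

lemma Re_one_plus_square_pos:
  assumes "norm (w :: complex) < 1"
  shows "Re (1 + w\<^sup>2) > 0"
proof -
  have "\<bar>Re (w\<^sup>2)\<bar> \<le> (norm w)\<^sup>2"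
    using abs_Re_le_cmod[of "w\<^sup>2"] by (simp add: norm_power)
  moreover have "(norm w)\<^sup>2 < 1"
    using assms by (simp add: power_less_one_iff abs_square_less_1)
  ultimately show ?thesis
    by simp
qed

lemma holomorphic_csqrt_one_plus_square:
  "(\<lambda>w. csqrt (1 + w\<^sup>2)) holomorphic_on ball 0 1"
  by (intro holomorphic_intros)
     (use Re_one_plus_square_pos in \<open>force simp: complex_nonpos_Reals_iff\<close>)

lemma holomorphic_q_lune: "q_lune holomorphic_on ball 0 1"
  unfolding q_lune_def[abs_def] by (intro holomorphic_intros holomorphic_csqrt_one_plus_square)

text \<open>
  This equation replaces the Taylor series of the square root in the coefficient computation: it turns
  the subordination to \<open>q\<close> into a polynomial identity between \<open>f''/f'\<close> and the Schwarz function.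
\<close>

lemma q_lune_quadratic: "(q_lune w)\<^sup>2 - 2 * w * q_lune w = 1"
proof -
  have "(q_lune w - w)\<^sup>2 = 1 + w\<^sup>2"
    by (simp add: q_lune_def)
  thus ?thesis
    by (simp add: power2_eq_square algebra_simps)
qed

lemma q_lune_eq_1_iff: "q_lune w = 1 \<longleftrightarrow> w = 0"
  using q_lune_quadratic[of w] by (auto simp: q_lune_def)

lemma has_fps_expansion_if_holomorphic:
  assumes "f holomorphic_on ball 0 1"
  shows "f has_fps_expansion fps_expansion f 0"
  using assms by (intro has_fps_expansion_fps_expansion[of "ball 0 1"]) auto

lemma holomorphic_pre_schwarzian:
  assumes "f holomorphic_on ball 0 1" "\<And>z. z \<in> ball 0 1 \<Longrightarrow> deriv f z \<noteq> 0"
  shows "pre_schwarzian f holomorphic_on ball 0 1"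
proof -
  have "(\<lambda>z. deriv (deriv f) z / deriv f z) holomorphic_on ball 0 1"
    using assms by (intro holomorphic_intros) auto
  thus ?thesis
    by (simp add: pre_schwarzian_def[abs_def])
qed

lemma schippers_at_0_pre_schwarzian:
  assumes "pre_schwarzian f has_fps_expansion P"
  shows "schippers 3 f 0 = fps_nth P 1 - (fps_nth P 0)\<^sup>2 / 2"
    and "schippers 4 f 0 = 2 * fps_nth P 2 - 3 * fps_nth P 0 * fps_nth P 1 + (fps_nth P 0) ^ 3"
proof -
  let ?S3 = "fps_deriv P - fps_const (1 / 2) * P ^ 2"
  let ?S4 = "fps_deriv ?S3 - fps_const 2 * ?S3 * P"
  have eq3: "schippers 3 f = (\<lambda>z. deriv (pre_schwarzian f) z - 1 / 2 * (pre_schwarzian f z)\<^sup>2)"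
    by (simp add: numeral_3_eq_3)
  have eq4: "schippers 4 f = (\<lambda>z. deriv (schippers 3 f) z - 2 * schippers 3 f z * pre_schwarzian f z)"
    by (simp add: eval_nat_numeral)
  have S3: "schippers 3 f has_fps_expansion ?S3"
    unfolding eq3 by (intro fps_expansion_intros assms)
  have S4: "schippers 4 f has_fps_expansion ?S4"
    unfolding eq4 by (intro fps_expansion_intros assms S3)
  show "schippers 3 f 0 = fps_nth P 1 - (fps_nth P 0)\<^sup>2 / 2"
    using has_fps_expansion_imp_0_eq_fps_nth_0[OF S3] by (simp add: power2_eq_square)
  show "schippers 4 f 0 = 2 * fps_nth P 2 - 3 * fps_nth P 0 * fps_nth P 1 + (fps_nth P 0) ^ 3"
    unfolding has_fps_expansion_imp_0_eq_fps_nth_0[OF S4]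
    by (simp add: power2_eq_square power3_eq_cube fps_mult_nth_1 numeral_2_eq_2 algebra_simps)
qed

text \<open>
  The quadratic equation for \<open>q\<close> becomes an identity of power series relating \<open>f''/f'\<close> and \<open>w\<close>;
  its coefficient of \<open>z\<^sup>k\<^sup>+\<^sup>1\<close> contains the \<open>k\<close>-th coefficient of \<open>f''/f'\<close> only linearly, with factor 2,
  and otherwise earlier ones, so \<open>k = 0, 1, 2\<close> give these coefficients one after the other.
\<close>

lemma schippers_at_0_schwarz:
  assumes f: "f holomorphic_on ball 0 1" "\<And>z. z \<in> ball 0 1 \<Longrightarrow> deriv f z \<noteq> 0"
    and w: "w has_fps_expansion W" "w 0 = 0"
    and eq: "\<And>z. z \<in> ball 0 1 \<Longrightarrow> 1 + z * deriv (deriv f) z / deriv f z = q_lune (w z)"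
  shows "schippers 3 f 0 = fps_nth W 2"
    and "schippers 4 f 0 = 2 * fps_nth W 3 - fps_nth W 1 * fps_nth W 2 - (fps_nth W 1) ^ 3 / 2"
proof -
  define P where "P = fps_expansion (pre_schwarzian f) 0"
  have P: "pre_schwarzian f has_fps_expansion P"
    unfolding P_def by (intro has_fps_expansion_if_holomorphic holomorphic_pre_schwarzian f)
  define Q where "Q = 1 + fps_X * P"
  let ?q = "\<lambda>z. 1 + z * pre_schwarzian f z"
  have "(\<lambda>z. (?q z)\<^sup>2 - 2 * w z * ?q z) has_fps_expansion Q ^ 2 - fps_const 2 * W * Q"
    unfolding Q_def by (intro fps_expansion_intros P w)
  moreover have "eventually (\<lambda>z. (?q z)\<^sup>2 - 2 * w z * ?q z = 1) (nhds 0)"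
  proof -
    have "eventually (\<lambda>z. z \<in> ball 0 1) (nhds (0 :: complex))"
      by (intro eventually_nhds_in_open) auto
    thus ?thesis
    proof eventually_elim
      case (elim z)
      thus ?case
        using q_lune_quadratic[of "w z"] eq[of z] by (simp add: pre_schwarzian_def)
    qed
  qed
  ultimately have "(\<lambda>z. 1) has_fps_expansion Q ^ 2 - fps_const 2 * W * Q"
    by (subst (asm) has_fps_expansion_cong) auto
  hence quad: "Q ^ 2 - fps_const 2 * W * Q = 1"
    using has_fps_expansion_1 fps_expansion_unique_complex by blast
  have W0: "fps_nth W 0 = 0"
    using has_fps_expansion_imp_0_eq_fps_nth_0[OF w(1)] w(2) by simp
  have nth: "fps_nth (Q ^ 2 - fps_const 2 * W * Q) n = fps_nth 1 n" for n
    by (simp only: quad)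
  have Q: "fps_nth Q 0 = 1" "fps_nth Q (Suc n) = fps_nth P n" for n
    by (simp_all add: Q_def)
  have p0: "fps_nth P 0 = fps_nth W 1"
    using nth[of 1] by (simp add: power2_eq_square fps_mult_nth Q W0 mult.assoc)
  have p1: "fps_nth P 1 = fps_nth W 2 + (fps_nth W 1)\<^sup>2 / 2"
    using nth[of 2] p0
    by (simp add: power2_eq_square fps_mult_nth Q W0 numeral_2_eq_2 mult.assoc field_simps)
  have "2 * fps_nth P 2 = 2 * (fps_nth W 3 + fps_nth W 1 * fps_nth W 2)"
    using nth[of 3] p0 p1
    by (simp add: power2_eq_square fps_mult_nth Q W0 numeral_2_eq_2 numeral_3_eq_3 mult.assoc field_simps)
  hence p2: "fps_nth P 2 = fps_nth W 3 + fps_nth W 1 * fps_nth W 2"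
    unfolding mult_cancel_left by simp
  show "schippers 3 f 0 = fps_nth W 2"
    by (simp add: schippers_at_0_pre_schwarzian(1)[OF P] p0 p1[simplified])
  show "schippers 4 f 0 = 2 * fps_nth W 3 - fps_nth W 1 * fps_nth W 2 - (fps_nth W 1) ^ 3 / 2"
    unfolding schippers_at_0_pre_schwarzian(2)[OF P] p0 p1 p2
    by (simp add: power2_eq_square power3_eq_cube field_simps)
qed

text \<open>
  The second expression is twice the coefficient \<open>F\<close> of \<open>z\<^sup>3\<close> in \<open>w p\<close>, where
  \<open>p = 1 - c\<^sub>1 z/2 - c\<^sub>1\<^sup>2 z\<^sup>2/4\<close> and \<open>c\<^sub>1\<close> is the coefficient of \<open>z\<close> in \<open>w\<close>, so the contraction
  principle bounds it. Its price, the norm of \<open>p\<close>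
  exceeding 1, is covered by the coefficient \<open>c\<^sub>1\<close> of \<open>z\<close> in \<open>w p\<close>.
\<close>

lemma schwarz_coefficient_bounds:
  assumes "schwarz_function w" "w has_fps_expansion W"
  shows "norm (fps_nth W n) \<le> 1"
    and "norm (2 * fps_nth W 3 - fps_nth W 1 * fps_nth W 2 - (fps_nth W 1) ^ 3 / 2) \<le> 2"
proof -
  have w: "w holomorphic_on ball 0 1" "\<And>z. z \<in> ball 0 1 \<Longrightarrow> norm (w z) \<le> 1" "w 0 = 0"
    using assms(1) by (auto simp: schwarz_function_def less_imp_le)
  have W0: "fps_nth W 0 = 0"
    using has_fps_expansion_imp_0_eq_fps_nth_0[OF assms(2)] w(3) by simp
  note contraction = bounded_multiplier_contraction[OF w(1) assms(2) w(2)]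
  show le1: "norm (fps_nth W n) \<le> 1" for n
  proof -
    have "(norm (fps_nth W n))\<^sup>2 \<le> (\<Sum>k\<le>n. (norm (fps_nth W k))\<^sup>2)"
      by (intro member_le_sum) auto
    also have "\<dots> \<le> 1"
      using contraction[where n = n and p = 1] by simp
    finally show ?thesis
      by (simp add: abs_square_le_1)
  qed
  define c1 c2 c3 where "c1 = fps_nth W 1" "c2 = fps_nth W 2" "c3 = fps_nth W 3"
  define p where "p = [:1, - c1 / 2, - c1\<^sup>2 / 4:]"
  define F where "F = c3 - c1 * c2 / 2 - c1 ^ 3 / 4"
  define a where "a = norm c1"
  have nth: "fps_nth (W * fps_of_poly p) 1 = c1" "fps_nth (W * fps_of_poly p) 3 = F"
    by (simp_all add: fps_mult_nth W0 p_def F_def c1_c2_c3_def numeral_2_eq_2 numeral_3_eq_3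
          power2_eq_square power3_eq_cube)
  have "a\<^sup>2 + (norm F)\<^sup>2 = (\<Sum>k\<in>{1, 3}. (norm (fps_nth (W * fps_of_poly p) k))\<^sup>2)"
    by (simp add: nth a_def del: fps_mult_nth_1 One_nat_def)
  also have "\<dots> \<le> (\<Sum>k\<le>3. (norm (fps_nth (W * fps_of_poly p) k))\<^sup>2)"
    by (intro sum_mono2) auto
  also have "\<dots> \<le> (\<Sum>k\<le>degree p. (norm (coeff p k))\<^sup>2)"
    by (rule contraction)
  also have "\<dots> \<le> (\<Sum>k\<le>2. (norm (coeff p k))\<^sup>2)"
    by (intro sum_mono2) (auto simp: p_def)
  also have "\<dots> = 1 + a\<^sup>2 / 4 + a ^ 4 / 16"
    by (simp add: p_def a_def numeral_2_eq_2 norm_divide norm_mult norm_power power_divide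
          power4_eq_xxxx mult.assoc)
  finally have "(norm F)\<^sup>2 \<le> 1 - 3 / 4 * a\<^sup>2 + a ^ 4 / 16"
    by simp
  moreover have "a ^ 4 \<le> a\<^sup>2"
    using le1[of 1] by (intro power_decreasing) (auto simp: a_def c1_c2_c3_def)
  ultimately have "(norm F)\<^sup>2 \<le> 1"
    using zero_le_power2[of a] by linarith
  hence "norm F \<le> 1"
    by (simp add: abs_square_le_1)
  moreover have "2 * c3 - c1 * c2 - c1 ^ 3 / 2 = 2 * F"
    by (simp add: F_def field_simps)
  ultimately show "norm (2 * fps_nth W 3 - fps_nth W 1 * fps_nth W 2 - (fps_nth W 1) ^ 3 / 2) \<le> 2"
    by (simp add: c1_c2_c3_def norm_mult)
qed

section \<open>Univalence and uniqueness\<close>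

text \<open>
  The Noshiro-Warschawski criterion. Along the segment from \<open>a\<close> to \<open>b\<close> the real part of
  \<open>f / (b - a)\<close> has derivative \<open>Re f'\<close>, so it strictly increases and \<open>f a \<noteq> f b\<close>.
\<close>

lemma inj_on_if_Re_deriv_pos:
  assumes "convex S" "open S" "f holomorphic_on S" "\<And>z. z \<in> S \<Longrightarrow> Re (deriv f z) > 0"
  shows "inj_on f S"
proof (rule inj_onI, rule ccontr)
  fix a b assume ab: "a \<in> S" "b \<in> S" "f a = f b" "a \<noteq> b"
  define \<gamma> where "\<gamma> t = a + of_real t * (b - a)" for t
  define g where "g t = Re (f (\<gamma> t) / (b - a))" for t
  have "g 0 < g 1"
  proof (rule DERIV_pos_imp_increasing[of 0 1 g])
    fix t :: real assume t: "0 \<le> t" "t \<le> 1"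
    have "\<gamma> t = (1 - t) *\<^sub>R a + t *\<^sub>R b"
      by (simp add: \<gamma>_def scaleR_conv_of_real algebra_simps)
    hence mem: "\<gamma> t \<in> S"
      using convexD_alt[OF assms(1) ab(1,2) t] by simp
    have "(\<gamma> has_vector_derivative (b - a)) (at t)"
      unfolding \<gamma>_def by (auto intro!: derivative_eq_intros)
    moreover have "(f has_field_derivative deriv f (\<gamma> t)) (at (\<gamma> t))"
      using assms mem holomorphic_derivI by blast
    ultimately have "((f \<circ> \<gamma>) has_vector_derivative (b - a) * deriv f (\<gamma> t)) (at t)"
      by (rule field_vector_diff_chain_at)
    hence "((\<lambda>t. f (\<gamma> t) / (b - a)) has_vector_derivative (b - a) * deriv f (\<gamma> t) / (b - a)) (at t)"
      unfolding comp_def by (intro has_vector_derivative_divide)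
    hence "(g has_field_derivative Re (deriv f (\<gamma> t))) (at t)"
      unfolding g_def using ab(4)
      by (auto dest: bounded_linear.has_vector_derivative[OF bounded_linear_Re]
               simp: has_real_derivative_iff_has_vector_derivative)
    thus "\<exists>y. (g has_real_derivative y) (at t) \<and> 0 < y"
      using assms(4)[OF mem] by blast
  qed auto
  thus False
    using ab by (simp add: g_def \<gamma>_def)
qed

text \<open>
  Equality of \<open>f''/f'\<close> and \<open>g''/g'\<close> means that \<open>g'/f'\<close> has derivative 0; the normalization then
  identifies first the derivatives and then the functions. The origin is left out because the
  equation \<open>1 + z f''/f' = q(\<omega>)\<close> says nothing about \<open>f''/f'\<close> there; one exceptional point does
  not affect the constancy of \<open>g'/f'\<close>, by continuity.
\<close>

lemma eq_if_pre_schwarzian_eq: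
  assumes f: "f \<in> class_A" and g: "g \<in> class_A"
    and nz: "\<And>z. z \<in> ball 0 1 \<Longrightarrow> deriv f z \<noteq> 0" "\<And>z. z \<in> ball 0 1 \<Longrightarrow> deriv g z \<noteq> 0"
    and eq: "\<And>z. z \<in> ball 0 1 \<Longrightarrow> z \<noteq> 0 \<Longrightarrow> pre_schwarzian f z = pre_schwarzian g z"
    and "z \<in> ball 0 1"
  shows "f z = g z"
proof -
  have hol: "f holomorphic_on ball 0 1" "g holomorphic_on ball 0 1"
    "deriv f holomorphic_on ball 0 1" "deriv g holomorphic_on ball 0 1"
    using f g by (auto simp: class_A_def intro!: holomorphic_deriv)
  obtain c where c: "deriv g z / deriv f z = c" if "z \<in> ball 0 1" for z
  proof (rule DERIV_zero_connected_constant)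
    show "continuous_on (ball 0 1) (\<lambda>z. deriv g z / deriv f z)"
      using hol nz by (intro continuous_intros holomorphic_on_imp_continuous_on) auto
    show "\<forall>z\<in>ball 0 1 - {0}. ((\<lambda>z. deriv g z / deriv f z) has_field_derivative 0) (at z)"
    proof
      fix z :: complex assume z: "z \<in> ball 0 1 - {0}"
      have "((\<lambda>z. deriv g z / deriv f z) has_field_derivative
          (deriv (deriv g) z * deriv f z - deriv g z * deriv (deriv f) z) / (deriv f z * deriv f z)) (at z)"
        using z nz hol by (intro DERIV_divide holomorphic_derivI[of _ "ball 0 1"]) auto
      thus "((\<lambda>z. deriv g z / deriv f z) has_field_derivative 0) (at z)"
        using eq[of z] nz[of z] z by (simp add: pre_schwarzian_def field_simps)
    qed
  qed (auto intro: that)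
  have c1: "c = 1"
    using c[of 0] f g by (auto simp: class_A_def)
  obtain d where d: "f z - g z = d" if "z \<in> ball 0 1" for z
  proof (rule DERIV_zero_connected_constant)
    show "continuous_on (ball 0 1) (\<lambda>z. f z - g z)"
      using hol by (intro continuous_intros holomorphic_on_imp_continuous_on) auto
    show "\<forall>z\<in>ball 0 1 - {}. ((\<lambda>z. f z - g z) has_field_derivative 0) (at z)"
    proof
      fix z :: complex assume z: "z \<in> ball 0 1 - {}"
      have "((\<lambda>z. f z - g z) has_field_derivative deriv f z - deriv g z) (at z)"
        using z hol by (intro DERIV_diff holomorphic_derivI[of _ "ball 0 1"]) auto
      thus "((\<lambda>z. f z - g z) has_field_derivative 0) (at z)"
        using c[of z] nz[of z] z c1 by (simp add: field_simps)
    qed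
  qed (auto intro: that)
  have "d = 0"
    using d[of 0] f g by (auto simp: class_A_def)
  thus ?thesis
    using d[OF assms(6)] by simp
qed

text \<open>
  Injectivity of \<open>f\<close> keeps \<open>f'\<close> from vanishing, so the quotient \<open>f''/f'\<close> in the definition of the
  class is a genuine one.
\<close>

lemma lune_convexD:
  assumes "f \<in> lune_convex"
  shows "f \<in> class_A" and "z \<in> ball 0 1 \<Longrightarrow> deriv f z \<noteq> 0"
    and "\<exists>w. schwarz_function w \<and>
           (\<forall>z\<in>ball 0 1. 1 + z * deriv (deriv f) z / deriv f z = q_lune (w z))"
proof -
  have f: "f holomorphic_on ball 0 1" "inj_on f (ball 0 1)"
    using assms by (auto simp: lune_convex_def class_S_def class_A_def)
  show "f \<in> class_A"
    using assms by (auto simp: lune_convex_def class_S_def)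
  show "deriv f z \<noteq> 0" if "z \<in> ball 0 1"
    using holomorphic_injective_imp_regular[OF f(1) _ f(2) that] by simp
  show "\<exists>w. schwarz_function w \<and>
      (\<forall>z\<in>ball 0 1. 1 + z * deriv (deriv f) z / deriv f z = q_lune (w z))"
  proof -
    have "subordinate (\<lambda>z. 1 + z * deriv (deriv f) z / deriv f z) q_lune"
      using assms by (simp add: lune_convex_def)
    thus ?thesis
      by (simp only: subordinate_def)
  qed
qed

text \<open>
  Functions in \<open>class_A\<close> may have critical points, but the equation excludes them: at a zero of \<open>g'\<close>
  the quotient \<open>g''/g'\<close> takes the default value 0 of division by zero, so \<open>q(z\<^sup>k) = 1\<close>, which
  happens only at the origin, where \<open>g' = 1\<close>.
\<close>

lemma lune_convex_power_unique:
  fixes k :: nat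
  assumes "k \<ge> 1" "f \<in> class_A" "g \<in> class_A"
    and "\<And>z. z \<in> ball 0 1 \<Longrightarrow> 1 + z * deriv (deriv f) z / deriv f z = q_lune (z ^ k)"
    and "\<And>z. z \<in> ball 0 1 \<Longrightarrow> 1 + z * deriv (deriv g) z / deriv g z = q_lune (z ^ k)"
    and "z \<in> ball 0 1"
  shows "f z = g z"
proof -
  have nz: "deriv h z \<noteq> 0"
    if "h \<in> class_A" "z \<in> ball 0 1"
      "\<And>z. z \<in> ball 0 1 \<Longrightarrow> 1 + z * deriv (deriv h) z / deriv h z = q_lune (z ^ k)" for h z
  proof
    assume "deriv h z = 0"
    with that(3)[OF that(2)] have "q_lune (z ^ k) = 1"
      by simp
    hence "z = 0"
      using assms(1) by (simp add: q_lune_eq_1_iff)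
    thus False
      using that(1) \<open>deriv h z = 0\<close> by (simp add: class_A_def)
  qed
  have "pre_schwarzian f z = pre_schwarzian g z" if "z \<in> ball 0 1" "z \<noteq> 0" for z
  proof -
    have "1 + z * pre_schwarzian f z = 1 + z * pre_schwarzian g z"
      using assms(4,5)[OF that(1)] by (simp add: pre_schwarzian_def)
    thus ?thesis
      using that(2) by simp
  qed
  from eq_if_pre_schwarzian_eq[OF assms(2,3) _ _ this assms(6)] show ?thesis
    using nz[OF assms(2) _ assms(4)] nz[OF assms(3) _ assms(5)] by blast
qed

section \<open>Extremal functions\<close>

text \<open>
  Rationalizing the square root gives \<open>q(w) = 1 + w \<kappa>(w)\<close> with
  \<open>\<kappa>(w) = 1 + w / (1 + sqrt (1 + w\<^sup>2))\<close>, which is visibly holomorphic and bounded by 2, because the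
  principal square root has nonnegative real part. If \<open>K' = \<kappa>\<close>, then \<open>L(z) = (K(z\<^sup>k) - K(0)) / k\<close>
  satisfies \<open>z L'(z) = q(z\<^sup>k) - 1\<close>, so \<open>f' = exp L\<close> solves the equation. The bound on \<open>\<kappa>\<close> gives
  \<open>\<bar>L\<bar> \<le> 2/k \<le> 1\<close>, and \<open>Re f' > 0\<close> follows from \<open>1 < \<pi>/2\<close>.
\<close>

lemma lune_convex_power_exists:
  fixes k :: nat
  assumes "k \<ge> 2"
  shows "\<exists>f\<in>lune_convex. \<forall>z\<in>ball 0 1. 1 + z * deriv (deriv f) z / deriv f z = q_lune (z ^ k)"
proof -
  define s where "s w = 1 + csqrt (1 + w\<^sup>2)" for w
  define \<kappa> where "\<kappa> w = 1 + w / s w" for w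
  have s: "Re (s w) \<ge> 1" for w
    using csqrt_principal[of "1 + w\<^sup>2"] by (auto simp: s_def)
  have s_nz: "s w \<noteq> 0" for w
    using s[of w] by auto
  have q: "q_lune w = 1 + w * \<kappa> w" for w
  proof -
    have "(s w - 1)\<^sup>2 = 1 + w\<^sup>2"
      by (simp add: s_def)
    thus ?thesis
      using s_nz[of w] by (simp add: q_lune_def \<kappa>_def s_def field_simps power2_eq_square)
  qed
  have \<kappa>_le: "norm (\<kappa> w) \<le> 2" if "w \<in> ball 0 1" for w
  proof -
    have "1 \<le> norm (s w)"
      using s[of w] complex_Re_le_cmod[of "s w"] by linarith
    hence "norm (w / s w) \<le> 1"
      using that by (auto simp: norm_divide divide_le_eq)
    thus ?thesis
      unfolding \<kappa>_def using norm_triangle_ineq[of 1 "w / s w"] by simp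
  qed
  have "\<kappa> holomorphic_on ball 0 1"
    unfolding \<kappa>_def s_def
    using s_nz[unfolded s_def]
    by (intro holomorphic_intros holomorphic_csqrt_one_plus_square) auto
  then obtain K where K: "(K has_field_derivative \<kappa> w) (at w within ball 0 1)" if "w \<in> ball 0 1" for w
    using holomorphic_convex_primitive'[of "ball 0 1" \<kappa>] by auto
  hence K': "(K has_field_derivative \<kappa> w) (at w)" if "w \<in> ball 0 1" for w
    using that by (metis at_within_open open_ball)
  define L where "L z = (K (z ^ k) - K 0) / of_nat k" for z
  have pow_in: "z ^ k \<in> ball 0 1" if "z \<in> ball 0 1" for z :: complex
    using that assms by (simp add: norm_power power_less_one_iff)
  have L: "(L has_field_derivative z ^ (k - 1) * \<kappa> (z ^ k)) (at z)" if "z \<in> ball 0 1" for z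
  proof -
    have "((\<lambda>z. z ^ k) has_field_derivative of_nat k * z ^ (k - 1)) (at z)"
      by (auto intro!: derivative_eq_intros)
    hence "((\<lambda>z. K (z ^ k)) has_field_derivative \<kappa> (z ^ k) * (of_nat k * z ^ (k - 1))) (at z)"
      by (rule DERIV_chain2[of K "\<kappa> (z ^ k)" "\<lambda>z. z ^ k", OF K'[OF pow_in[OF that]]])
    hence "(L has_field_derivative (\<kappa> (z ^ k) * (of_nat k * z ^ (k - 1)) - 0) / of_nat k) (at z)"
      unfolding L_def by (intro DERIV_cdivide DERIV_diff DERIV_const)
    thus ?thesis
      using assms by (simp add: mult.commute)
  qed
  have norm_L: "norm (L z) \<le> 1" if "z \<in> ball 0 1" for z
  proof -
    have "norm (K (z ^ k) - K 0) \<le> 2 * norm (z ^ k - 0)"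
      by (rule field_differentiable_bound[where S = "ball 0 1" and f' = \<kappa>])
         (use K \<kappa>_le pow_in[OF that] in auto)
    also have "\<dots> \<le> 2"
      using pow_in[OF that] by simp
    also have "\<dots> \<le> real k"
      using assms by simp
    finally show ?thesis
      using assms by (simp add: L_def norm_divide divide_le_eq)
  qed
  have "L holomorphic_on ball 0 1"
    unfolding holomorphic_on_open[OF open_ball] using L by blast
  hence "(\<lambda>z. exp (L z)) holomorphic_on ball 0 1"
    by (intro holomorphic_intros)
  then obtain H where "(H has_field_derivative exp (L z)) (at z within ball 0 1)"
    if "z \<in> ball 0 1" for z
    using holomorphic_convex_primitive'[of "ball 0 1" "\<lambda>z. exp (L z)"] by auto
  hence H: "(H has_field_derivative exp (L z)) (at z)" if "z \<in> ball 0 1" for z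
    using that by (metis at_within_open open_ball)
  define f where "f z = H z - H 0" for z
  have f: "(f has_field_derivative exp (L z)) (at z)" if "z \<in> ball 0 1" for z
    unfolding f_def using H[OF that] by (auto intro!: derivative_eq_intros)
  have deriv_f: "deriv f z = exp (L z)" if "z \<in> ball 0 1" for z
    using f[OF that] by (rule DERIV_imp_deriv)
  have hol_f: "f holomorphic_on ball 0 1"
    unfolding holomorphic_on_open[OF open_ball] using f by blast
  have deriv2_f: "deriv (deriv f) z = exp (L z) * (z ^ (k - 1) * \<kappa> (z ^ k))" if "z \<in> ball 0 1" for z
  proof -
    have "((\<lambda>z. exp (L z)) has_field_derivative exp (L z) * (z ^ (k - 1) * \<kappa> (z ^ k))) (at z)"
      using L[OF that] by (auto intro!: derivative_eq_intros)
    hence "(deriv f has_field_derivative exp (L z) * (z ^ (k - 1) * \<kappa> (z ^ k))) (at z)"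
      by (rule has_field_derivative_transform_within_open[of _ _ _ "ball 0 1"])
         (use that deriv_f in auto)
    thus ?thesis
      by (rule DERIV_imp_deriv)
  qed
  have eq: "1 + z * deriv (deriv f) z / deriv f z = q_lune (z ^ k)" if "z \<in> ball 0 1" for z
  proof -
    have "z * z ^ (k - 1) = z ^ k"
      using assms by (cases k) auto
    thus ?thesis
      using that by (simp add: deriv_f deriv2_f q mult.assoc[symmetric])
  qed
  have "Re (deriv f z) > 0" if "z \<in> ball 0 1" for z
  proof -
    have "\<bar>Im (L z)\<bar> \<le> 1"
      using norm_L[OF that] abs_Im_le_cmod[of "L z"] by linarith
    hence "cos (Im (L z)) > 0"
      using pi_gt3 by (intro cos_gt_zero_pi) auto
    thus ?thesis
      by (simp add: deriv_f[OF that] Re_exp)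
  qed
  hence "inj_on f (ball 0 1)"
    by (intro inj_on_if_Re_deriv_pos hol_f) auto
  moreover have "deriv f 0 = 1"
    using assms by (simp add: deriv_f L_def zero_power)
  ultimately have "f \<in> class_S"
    using hol_f by (simp add: class_S_def class_A_def f_def)
  moreover have "schwarz_function (\<lambda>z. z ^ k)"
    using pow_in assms by (auto simp: schwarz_function_def intro!: holomorphic_intros)
  moreover have "(\<lambda>z. 1 + z * deriv (deriv f) z / deriv f z) holomorphic_on ball 0 1"
    using hol_f deriv_f by (intro holomorphic_intros) auto
  ultimately have "f \<in> lune_convex"
    using eq holomorphic_q_lune by (auto simp: lune_convex_def subordinate_def)
  thus ?thesis
    using eq by blast
qed

lemma lune_convex_power_extremal:
  fixes k :: nat
  assumes "k \<ge> 2"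
  shows "\<exists>f\<in>lune_convex.
    (\<forall>z\<in>ball 0 1. 1 + z * deriv (deriv f) z / deriv f z = q_lune (z ^ k)) \<and>
    (\<forall>g\<in>class_A. (\<forall>z\<in>ball 0 1. 1 + z * deriv (deriv g) z / deriv g z = q_lune (z ^ k))
       \<longrightarrow> (\<forall>z\<in>ball 0 1. g z = f z)) \<and>
    (k = 2 \<longrightarrow> norm (schippers 3 f 0) = 1) \<and> (k = 3 \<longrightarrow> norm (schippers 4 f 0) = 2)"
proof -
  obtain f where f: "f \<in> lune_convex"
      "\<And>z. z \<in> ball 0 1 \<Longrightarrow> 1 + z * deriv (deriv f) z / deriv f z = q_lune (z ^ k)"
    using lune_convex_power_exists[OF assms] by blast
  note A = lune_convexD(1)[OF f(1)] and nz = lune_convexD(2)[OF f(1)]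
  have pow: "(\<lambda>z. z ^ k) has_fps_expansion fps_X ^ k"
    by (intro fps_expansion_intros)
  have hol: "f holomorphic_on ball 0 1" and zero: "(0 :: complex) ^ k = 0"
    using A assms by (simp_all add: class_A_def)
  have "schippers 3 f 0 = fps_nth (fps_X ^ k) 2"
    by (rule schippers_at_0_schwarz(1)[OF hol _ pow zero]) (fact nz f(2))+
  hence 3: "k = 2 \<longrightarrow> norm (schippers 3 f 0) = 1"
    by (auto simp: fps_X_power_nth)
  have "schippers 4 f 0 = 2 * fps_nth (fps_X ^ k) 3 -
      fps_nth (fps_X ^ k) 1 * fps_nth (fps_X ^ k) 2 - (fps_nth (fps_X ^ k) 1) ^ 3 / 2"
    by (rule schippers_at_0_schwarz(2)[OF hol _ pow zero]) (fact nz f(2))+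
  hence 4: "k = 3 \<longrightarrow> norm (schippers 4 f 0) = 2"
    by (auto simp: fps_X_power_nth)
  have k1: "1 \<le> k"
    using assms by simp
  have unique: "g z = f z" if "g \<in> class_A" "z \<in> ball 0 1"
    and g: "\<forall>z\<in>ball 0 1. 1 + z * deriv (deriv g) z / deriv g z = q_lune (z ^ k)" for g z
    by (rule lune_convex_power_unique[OF k1 that(1) A bspec[OF g] f(2) that(2)])
  show ?thesis
    by (intro bexI[OF _ f(1)] conjI ballI) (use f(2) unique 3 4 in \<open>blast+\<close>)
qed

section \<open>The sharp estimates\<close>

theorem theorem3p2:
  shows "(\<forall>f\<in>lune_convex. norm (schippers 3 f 0) \<le> 1 \<and> norm (schippers 4 f 0) \<le> 2) \<and>
    (\<exists>f3\<in>lune_convex.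
       (\<forall>z\<in>ball 0 1. 1 + z * deriv (deriv f3) z / deriv f3 z = q_lune (z ^ 2)) \<and>
       (\<forall>g\<in>class_A. (\<forall>z\<in>ball 0 1. 1 + z * deriv (deriv g) z / deriv g z = q_lune (z ^ 2))
          \<longrightarrow> (\<forall>z\<in>ball 0 1. g z = f3 z)) \<and>
       norm (schippers 3 f3 0) = 1) \<and>
    (\<exists>f4\<in>lune_convex.
       (\<forall>z\<in>ball 0 1. 1 + z * deriv (deriv f4) z / deriv f4 z = q_lune (z ^ 3)) \<and>
       (\<forall>g\<in>class_A. (\<forall>z\<in>ball 0 1. 1 + z * deriv (deriv g) z / deriv g z = q_lune (z ^ 3))
          \<longrightarrow> (\<forall>z\<in>ball 0 1. g z = f4 z)) \<and>
       norm (schippers 4 f4 0) = 2)"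
proof (intro conjI ballI)
  fix f assume lune: "f \<in> lune_convex"
  note f = lune_convexD(1,2)[OF lune]
  from lune_convexD(3)[OF lune] obtain w where w: "schwarz_function w"
    and "\<forall>z\<in>ball 0 1. 1 + z * deriv (deriv f) z / deriv f z = q_lune (w z)"
    by (elim exE conjE)
  note eq = bspec[OF this(2)]
  have W: "w has_fps_expansion fps_expansion w 0"
    using w by (intro has_fps_expansion_if_holomorphic) (simp add: schwarz_function_def)
  have f0: "f holomorphic_on ball 0 1" and w0: "w 0 = 0"
    using f(1) w by (simp_all add: class_A_def schwarz_function_def)
  note bounds = schwarz_coefficient_bounds[OF w W]
  have "schippers 3 f 0 = fps_nth (fps_expansion w 0) 2"
    by (rule schippers_at_0_schwarz(1)[OF f0 _ W w0]) (fact f(2) eq)+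
  thus "norm (schippers 3 f 0) \<le> 1"
    by (simp only: bounds(1))
  have "schippers 4 f 0 = 2 * fps_nth (fps_expansion w 0) 3 -
      fps_nth (fps_expansion w 0) 1 * fps_nth (fps_expansion w 0) 2 -
      (fps_nth (fps_expansion w 0) 1) ^ 3 / 2"
    by (rule schippers_at_0_schwarz(2)[OF f0 _ W w0]) (fact f(2) eq)+
  thus "norm (schippers 4 f 0) \<le> 2"
    by (simp only: bounds(2))
next
  show "\<exists>f3\<in>lune_convex.
       (\<forall>z\<in>ball 0 1. 1 + z * deriv (deriv f3) z / deriv f3 z = q_lune (z ^ 2)) \<and>
       (\<forall>g\<in>class_A. (\<forall>z\<in>ball 0 1. 1 + z * deriv (deriv g) z / deriv g z = q_lune (z ^ 2))
          \<longrightarrow> (\<forall>z\<in>ball 0 1. g z = f3 z)) \<and>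
       norm (schippers 3 f3 0) = 1"
    using lune_convex_power_extremal[of 2, OF order.refl]
    by blast
next
  have "(2 :: nat) \<le> 3"
    by simp
  from lune_convex_power_extremal[OF this]
  show "\<exists>f4\<in>lune_convex.
       (\<forall>z\<in>ball 0 1. 1 + z * deriv (deriv f4) z / deriv f4 z = q_lune (z ^ 3)) \<and>
       (\<forall>g\<in>class_A. (\<forall>z\<in>ball 0 1. 1 + z * deriv (deriv g) z / deriv g z = q_lune (z ^ 3))
          \<longrightarrow> (\<forall>z\<in>ball 0 1. g z = f4 z)) \<and>
       norm (schippers 4 f4 0) = 2"
    by blast
qed

end
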